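(* Let $A$ be a Gorenstein algebra of finite vector space dimension greater than $1$ over a field $\mathbb{F}$ of characteristic zero, with maximal ideal $\mathfrak{m}$, and let $\pi$ be an admissible projection on $\mathfrak{m}$. If $A$ is graded, then the hypersurface $S_{\pi}$ is affine homogeneous.
   Context: Let $\mathbb{F}$ be a field of characteristic zero. A Gorenstein algebra of finite vector space dimension greater than $1$ over $\mathbb{F}$ is a local commutative associative unital $\mathbb{F}$-algebra $A$ with $1<\dim_{\mathbb{F}}A<\infty$ whose maximal ideal $\mathfrak{m}$ has 1-dimensional annihilator $\mathrm{Ann}(\mathfrak{m}):=\{u\in\mathfrak{m}: u\cdot\mathfrak{m}=0\}$ (dimension over $\mathbb{F}$). Let $\mathbf{1}$ be the unit of $A$. The ideal $\mathfrak{m}$ is nilpotent. Such an algebra is graded if $A=\bigoplus_{j\ge 0}A_j$ with $A_jA_k\subset A_{j+k}$ for all $j,k$, where the $A_j$ are linear subspaces of $A$ and $A_0\simeq\mathbb{F}$. An admissible projection on $\mathfrak{m}$ is an $\mathbb{F}$-linear projection $\pi:\mathfrak{m}\to\mathfrak{m}$ ($\pi^2=\pi$) with range $\mathrm{Ann}(\mathfrak{m})$. Define the affine quadric $Q'_{\pi}:=\{u\in\mathfrak{m}:\pi(2u+u^2)=0\}$ and the map $\log(\mathbf{1}+u):=\sum_{m=1}^{\infty}\frac{(-1)^{m+1}}{m}u^m\in\mathfrak{m}$ for $u\in\mathfrak{m}$ (a finite sum). The hypersurface associated to $\pi$ is $$S_{\pi}:=\{\log(\mathbf{1}+u): u\in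 Q'_{\pi}\}\subset\mathfrak{m}.$$ A subset $\mathcal{S}$ of an affine space $V$ is affine homogeneous if for every pair of points $p,q\in\mathcal{S}$ there exists a bijective affine map $\mathcal{A}$ of $V$ such that $\mathcal{A}(\mathcal{S})=\mathcal{S}$ and $\mathcal{A}(p)=q$. Here $V=\mathfrak{m}$ as an $\mathbb{F}$-vector space. *)

theory Defs
  imports Complex_Main "HOL-Library.Groups_Big_Fun"
begin

definition ring_ideal :: "'a::comm_ring_1 set \<Rightarrow> bool" where
  "ring_ideal I \<longleftrightarrow> 0 \<in> I \<and> (\<forall>x\<in>I. \<forall>y\<in>I. x + y \<in> I) \<and> (\<forall>r. \<forall>x\<in>I. r * x \<in> I)"

definition maximal_ideal :: "'a::comm_ring_1 set \<Rightarrow> bool" where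
  "maximal_ideal I \<longleftrightarrow> ring_ideal I \<and> I \<noteq> UNIV \<and>
     (\<forall>J. ring_ideal J \<and> I \<subseteq> J \<longrightarrow> J = I \<or> J = UNIV)"

definition annihilator :: "'a::comm_ring_1 set \<Rightarrow> 'a set" where
  "annihilator I = {u \<in> I. \<forall>v\<in>I. u * v = 0}"

locale comm_algebra = vector_space scale
  for scale :: "'f::field_char_0 \<Rightarrow> 'a::comm_ring_1 \<Rightarrow> 'a" (infixr \<open>*s\<close> 75) +
  assumes scale_mult_left: "(c *s x) * y = c *s (x * y)"

text \<open>The algebra is the whole type \<open>'a\<close>. Since \<^const>\<open>vector_space.dim\<close> is \<open>0\<close> on
  infinite-dimensional spaces, finite dimensionality is stated separately.\<close>

locale gorenstein_algebra = comm_algebra scale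
  for scale :: "'f::field_char_0 \<Rightarrow> 'a::comm_ring_1 \<Rightarrow> 'a" (infixr \<open>*s\<close> 75)
  and \<mm> :: "'a set" +
  assumes finite_dim: "\<exists>B. finite B \<and> span B = UNIV"
    and dim_gt_1: "dim UNIV > 1"
    and unique_maximal: "maximal_ideal I \<longleftrightarrow> I = \<mm>"
    and dim_annihilator: "dim (annihilator \<mm>) = 1"

text \<open>Direct sums are expressed by unique finitely supported decompositions, and \<open>A\<^sub>0 \<simeq> F\<close> as an
  isomorphism of vector spaces; an isomorphism of algebras is in particular one of these.\<close>

definition graded_algebra :: "('f::field_char_0 \<Rightarrow> 'a::comm_ring_1 \<Rightarrow> 'a) \<Rightarrow> bool" where
  "graded_algebra scale \<longleftrightarrow>
     (\<exists>A :: nat \<Rightarrow> 'a set.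
        (\<forall>j. module.subspace scale (A j)) \<and>
        (\<forall>x. \<exists>!c. (\<forall>j. c j \<in> A j) \<and> finite {j. c j \<noteq> 0} \<and> x = Sum_any c) \<and>
        (\<forall>j k. \<forall>x\<in>A j. \<forall>y\<in>A k. x * y \<in> A (j + k)) \<and>
        (\<exists>\<phi>. Vector_Spaces.linear (*) scale \<phi> \<and> bij_betw \<phi> UNIV (A 0)))"

text \<open>A map between subsets is a total function of which only the values on the source matter.
  In the following definitions \<open>V\<close> and \<open>W\<close> are meant to be linear subspaces.\<close>

definition linear_map_on ::
  "('f::field \<Rightarrow> 'v::ab_group_add \<Rightarrow> 'v) \<Rightarrow> 'v set \<Rightarrow> 'v set \<Rightarrow> ('v \<Rightarrow> 'v) \<Rightarrow> bool" where
  "linear_map_on scale V W f \<longleftrightarrow> f ` V \<subseteq> W \<and>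
     (\<forall>x\<in>V. \<forall>y\<in>V. f (x + y) = f x + f y) \<and> (\<forall>c. \<forall>x\<in>V. f (scale c x) = scale c (f x))"

definition affine_map_on ::
  "('f::field \<Rightarrow> 'v::ab_group_add \<Rightarrow> 'v) \<Rightarrow> 'v set \<Rightarrow> ('v \<Rightarrow> 'v) \<Rightarrow> bool" where
  "affine_map_on scale V f \<longleftrightarrow>
     (\<exists>L. linear_map_on scale V V L \<and> (\<exists>b\<in>V. \<forall>x\<in>V. f x = L x + b))"

definition affine_homogeneous ::
  "('f::field \<Rightarrow> 'v::ab_group_add \<Rightarrow> 'v) \<Rightarrow> 'v set \<Rightarrow> 'v set \<Rightarrow> bool" where
  "affine_homogeneous scale V S \<longleftrightarrow> S \<subseteq> V \<and>
     (\<forall>p\<in>S. \<forall>q\<in>S. \<exists>f. affine_map_on scale V f \<and> bij_betw f V V \<and> f ` S = S \<and> f p = q)"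

definition admissible_projection ::
  "('f::field \<Rightarrow> 'a::comm_ring_1 \<Rightarrow> 'a) \<Rightarrow> 'a set \<Rightarrow> ('a \<Rightarrow> 'a) \<Rightarrow> bool" where
  "admissible_projection scale \<mm> \<pi> \<longleftrightarrow>
     linear_map_on scale \<mm> \<mm> \<pi> \<and> (\<forall>u\<in>\<mm>. \<pi> (\<pi> u) = \<pi> u) \<and> \<pi> ` \<mm> = annihilator \<mm>"

definition affine_quadric :: "'a::comm_ring_1 set \<Rightarrow> ('a \<Rightarrow> 'a) \<Rightarrow> 'a set" where
  "affine_quadric \<mm> \<pi> = {u \<in> \<mm>. \<pi> (2 * u + u\<^sup>2) = 0}"

text \<open>The series of \<open>log (1 + u)\<close> with index shifted by one; it has finite support for
  nilpotent \<open>u\<close>.\<close>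

definition log_one_plus :: "('f::field_char_0 \<Rightarrow> 'a::comm_ring_1 \<Rightarrow> 'a) \<Rightarrow> 'a \<Rightarrow> 'a" where
  "log_one_plus scale u = Sum_any (\<lambda>n. scale ((-1) ^ n / of_nat (Suc n)) (u ^ Suc n))"

definition hypersurface ::
  "('f::field_char_0 \<Rightarrow> 'a::comm_ring_1 \<Rightarrow> 'a) \<Rightarrow> 'a set \<Rightarrow> ('a \<Rightarrow> 'a) \<Rightarrow> 'a set" where
  "hypersurface scale \<mm> \<pi> = log_one_plus scale ` affine_quadric \<mm> \<pi>"

end

theory Submission
  imports Defs "HOL-Computational_Algebra.Formal_Power_Series"
begin

text \<open>Write \<open>A = A\<^sub>0 \<oplus> \<dots> \<oplus> A\<^sub>d\<close> with \<open>A\<^sub>d = Ann(\<mm>)\<close>, and let \<open>\<omega>\<close> be the coordinate on \<open>A\<^sub>d\<close>. The form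
  \<open>\<omega> (x y)\<close> is nondegenerate, so \<open>\<pi> = \<omega> (g \<cdot>)\<close> on \<open>\<mm>\<close> for some \<open>g \<in> 1 + \<mm>\<close> with \<open>\<omega> g = 0\<close>, and \<open>S\<^sub>\<pi>\<close> consists
  of the \<open>log w\<close> with \<open>w \<in> 1 + \<mm>\<close> and \<open>\<omega> (g w\<^sup>2) = 0\<close>. The grading provides, for every \<open>h \<in> 1 + \<mm>\<close> with
  \<open>\<omega> h = 0\<close>, an algebra automorphism \<open>\<phi>\<close> with \<open>\<omega> (h \<phi> y) = \<omega> y\<close>. Given \<open>log v\<close> in \<open>S\<^sub>\<pi>\<close>, take such a \<open>\<phi>\<close> for
  \<open>h = g v\<^sup>2\<close>: since \<open>log\<close> is additive, the affine map \<open>x \<mapsto> \<phi> x + log v\<close> sends \<open>log w\<close> to \<open>log (v \<phi> w)\<close>,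
  and so it carries the hypersurface for \<open>g = 1\<close> onto \<open>S\<^sub>\<pi>\<close> and \<open>0\<close> to \<open>log v\<close>.\<close>

unbundle fps_syntax

section \<open>Evaluation of formal power series at nilpotent elements\<close>

lemma sum_mult_sum_triangle:
  fixes a b :: "nat \<Rightarrow> 'a::comm_semiring_0"
  assumes "\<And>i j. K \<le> i + j \<Longrightarrow> a i * b j = 0"
  shows "(\<Sum>i<K. a i) * (\<Sum>j<K. b j) = (\<Sum>n<K. \<Sum>i\<le>n. a i * b (n - i))"
proof -
  have "(\<Sum>i<K. a i) * (\<Sum>j<K. b j) = (\<Sum>(i, j)\<in>{..<K} \<times> {..<K}. a i * b j)"
    by (simp add: sum_product sum.cartesian_product)
  also have "\<dots> = (\<Sum>(i, j)\<in>{(i, j). i + j < K}. a i * b j)"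
    by (intro sum.mono_neutral_right) (use assms not_less in \<open>force+\<close>)
  also have "\<dots> = (\<Sum>n<K. \<Sum>i\<le>n. a i * b (n - i))"
    by (rule sum.triangle_reindex)
  finally show ?thesis .
qed

context comm_algebra
begin

lemma scale_mult_right: "x * (c *s y) = c *s (x * y)"
  using scale_mult_left[of c y x] by (simp add: mult.commute)

lemma of_nat_mult_scale: "of_nat m * z = (of_nat m :: 'f) *s z"
  by (induction m) (simp_all add: scale_left_distrib distrib_right)

text \<open>Substitution of \<open>u\<close> into a series. The cut-off \<open>K\<close> loses
  nothing once \<open>u ^ K = 0\<close>; then evaluation is a ring homomorphism, and identities
  between formal series carry over to nilpotent elements.\<close>

definition fps_eval :: "nat \<Rightarrow> 'a \<Rightarrow> 'f fps \<Rightarrow> 'a" where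
  "fps_eval K u F = (\<Sum>n<K. (F $ n) *s u ^ n)"

lemma fps_eval_diff: "fps_eval K u (F - G) = fps_eval K u F - fps_eval K u G"
  by (simp add: fps_eval_def scale_left_diff_distrib sum_subtractf)

lemma fps_eval_add: "fps_eval K u (F + G) = fps_eval K u F + fps_eval K u G"
  by (simp add: fps_eval_def scale_left_distrib sum.distrib)

lemma fps_eval_1:
  assumes "u ^ K = 0"
  shows "fps_eval K u 1 = 1"
proof -
  have "K \<noteq> 0"
    using assms by (cases K) auto
  then have "fps_eval K u 1 = (\<Sum>n<K. if n = 0 then 1 else 0)"
    unfolding fps_eval_def by (intro sum.cong) auto
  with \<open>K \<noteq> 0\<close> show ?thesis
    by simp
qed

lemma fps_eval_X:
  assumes "u ^ K = 0"
  shows "fps_eval K u fps_X = u"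
proof -
  have "fps_eval K u fps_X = (\<Sum>n<K. if n = 1 then u else 0)"
    unfolding fps_eval_def by (intro sum.cong) (auto simp: fps_X_def)
  also have "\<dots> = u"
  \<comment> \<open>For \<open>K \<le> 1\<close> the truncation drops the linear term, but then
    \<open>u\<close> itself is zero.\<close>
  proof (cases "1 < K")
    case False
    with assms have "u = 0"
      by (cases "K = 0") (auto simp: not_less le_Suc_eq)
    then show ?thesis by simp
  qed simp
  finally show ?thesis .
qed

lemma fps_eval_mult:
  assumes "u ^ K = 0"
  shows "fps_eval K u (F * G) = fps_eval K u F * fps_eval K u G"
proof -
  have nil: "u ^ n = 0" if "K \<le> n" for n
    using that assms by (metis le_add_diff_inverse mult_zero_left power_add)
  have "fps_eval K u F * fps_eval K u G
      = (\<Sum>n<K. \<Sum>i\<le>n. ((F $ i) *s u ^ i) * ((G $ (n - i)) *s u ^ (n - i)))"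
    unfolding fps_eval_def
    by (rule sum_mult_sum_triangle)
      (simp add: scale_mult_left scale_mult_right nil flip: power_add)
  also have "\<dots> = fps_eval K u (F * G)"
    unfolding fps_eval_def fps_mult_nth scale_sum_left atLeast0AtMost
    by (intro sum.cong refl)
      (simp add: scale_mult_left scale_mult_right mult.commute flip: power_add)
  finally show ?thesis ..
qed

lemma fps_eval_power:
  assumes "u ^ K = 0"
  shows "fps_eval K u (F ^ i) = fps_eval K u F ^ i"
  by (induction i) (simp_all add: fps_eval_1 fps_eval_mult assms)

text \<open>As \<open>G\<close> has no constant term, \<open>G ^ i\<close> has no coefficient below
  degree \<open>i\<close>. The inner sum over \<open>i \<le> n\<close> may therefore run over all
  \<open>i < K\<close>, and the two sums can be swapped.\<close>

lemma fps_eval_compose: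
  assumes "u ^ K = 0" "G $ 0 = 0"
  shows "fps_eval K u (F oo G) = fps_eval K (fps_eval K u G) F"
proof -
  have "fps_eval K u (F oo G) = (\<Sum>n<K. \<Sum>i=0..n. (F $ i * (G ^ i) $ n) *s u ^ n)"
    by (simp add: fps_eval_def fps_compose_nth scale_sum_left)
  also have "\<dots> = (\<Sum>n<K. \<Sum>i<K. (F $ i) *s (((G ^ i) $ n) *s u ^ n))"
    using assms(2)
    by (intro sum.cong refl sum.mono_neutral_cong_left)
      (auto simp: startsby_zero_power_prefix)
  also have "\<dots> = (\<Sum>i<K. (F $ i) *s fps_eval K u (G ^ i))"
    unfolding fps_eval_def scale_sum_right by (rule sum.swap)
  also have "\<dots> = fps_eval K (fps_eval K u G) F"
    unfolding fps_eval_power[OF assms(1)] by (simp add: fps_eval_def)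
  finally show ?thesis .
qed

text \<open>Lets nilpotency pass from \<open>u\<close> to series in \<open>u\<close>: a vanishing
  monomial stays zero when its factors are replaced by multiples.\<close>

lemma fps_eval_dvd:
  assumes "F $ 0 = 0"
  shows "u dvd fps_eval K u F"
  unfolding fps_eval_def
proof (rule dvd_sum)
  fix n
  show "u dvd (F $ n) *s u ^ n"
  proof (cases n)
    case (Suc m)
    have "(F $ n) *s u ^ n = u * ((F $ n) *s u ^ m)"
      by (simp add: Suc scale_mult_right)
    then show ?thesis by simp
  qed (simp add: assms)
qed

text \<open>By the binomial theorem the coefficients \<open>1 / fact n\<close> collapse the degree
  \<open>n\<close> part of the Cauchy product. The hypothesis concerns mixed monomials because
  \<open>x ^ K = 0\<close> and \<open>y ^ K = 0\<close> alone would leave products beyond the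
  cut-off.\<close>

lemma fps_eval_exp_add:
  assumes "\<And>i j. K \<le> i + j \<Longrightarrow> x ^ i * y ^ j = 0"
  shows "fps_eval K (x + y) (fps_exp 1) = fps_eval K x (fps_exp 1) * fps_eval K y (fps_exp 1)"
proof -
  have "fps_eval K x (fps_exp 1) * fps_eval K y (fps_exp 1)
      = (\<Sum>n<K. \<Sum>i\<le>n. ((fps_exp 1 $ i) *s x ^ i) * ((fps_exp 1 $ (n - i)) *s y ^ (n - i)))"
    unfolding fps_eval_def
    by (rule sum_mult_sum_triangle) (simp add: scale_mult_left scale_mult_right assms)
  also have "\<dots> = (\<Sum>n<K. (fps_exp 1 $ n) *s (x + y) ^ n)"
  proof (rule sum.cong[OF refl])
    fix n
    have "((fps_exp 1 $ i) *s x ^ i) * ((fps_exp 1 $ (n - i)) *s y ^ (n - i))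
        = (fps_exp 1 $ n) *s (of_nat (n choose i) * x ^ i * y ^ (n - i))" if "i \<le> n" for i
      using that
      by (simp add: scale_mult_left scale_mult_right of_nat_mult_scale mult.assoc
          binomial_fact field_simps)
    then show "(\<Sum>i\<le>n. ((fps_exp 1 $ i) *s x ^ i) * ((fps_exp 1 $ (n - i)) *s y ^ (n - i)))
        = (fps_exp 1 $ n) *s (x + y) ^ n"
      unfolding binomial_ring scale_sum_right by (intro sum.cong) auto
  qed
  finally show ?thesis
    unfolding fps_eval_def ..
qed

section \<open>The logarithm of unipotent elements\<close>

lemma log_one_plus_eq_fps_eval:
  assumes "u ^ K = 0"
  shows "log_one_plus scale u = fps_eval K u (fps_ln 1)"
proof -
  have nil: "u ^ n = 0" if "K \<le> n" for n
    using that assms by (metis le_add_diff_inverse mult_zero_left power_add)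
  have "log_one_plus scale u = (\<Sum>n<K. ((-1) ^ n / of_nat (Suc n)) *s u ^ Suc n)"
    unfolding log_one_plus_def
  proof (rule Sum_any.expand_superset)
    have "u ^ Suc n = 0" if "\<not> n < K" for n
      using that by (intro nil) simp
    then show "{n. ((-1) ^ n / of_nat (Suc n)) *s u ^ Suc n \<noteq> 0} \<subseteq> {..<K}"
      by force
  qed simp
  also have "\<dots> = (\<Sum>n<K. (fps_ln 1 $ Suc n) *s u ^ Suc n)"
    by (simp add: fps_ln_nth)
  \<comment> \<open>The constant coefficient of \<open>fps_ln 1\<close> is zero, so the index shift
    only adds a term that vanishes.\<close>
  also have "\<dots> = (\<Sum>n<Suc K. (fps_ln 1 $ n) *s u ^ n)"
    by (simp only: sum.lessThan_Suc_shift) simp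
  also have "\<dots> = fps_eval K u (fps_ln 1)"
    by (simp add: fps_eval_def assms)
  finally show ?thesis .
qed

text \<open>\<open>fps_ln 1\<close> is the compositional inverse of \<open>fps_exp 1 - 1\<close>.
  This order of composition recovers a logarithm from its exponential; the other one computes the
  exponential of a logarithm.\<close>

lemma fps_ln_oo_exp: "fps_ln 1 oo (fps_exp 1 - 1 :: 'f fps) = fps_X"
  unfolding fps_ln_fps_exp_inv[OF one_neq_zero] by (rule fps_inv) simp_all

lemma fps_exp_oo_ln: "fps_exp 1 oo fps_ln 1 = (1 + fps_X :: 'f fps)"
proof -
  have "(fps_exp 1 - 1) oo fps_ln 1 = (fps_X :: 'f fps)"
    unfolding fps_ln_fps_exp_inv[OF one_neq_zero] by (rule fps_inv_right) simp_all
  then show ?thesis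
    by (simp add: fps_compose_sub_distrib diff_eq_eq add.commute)
qed

text \<open>Both sides have the same exponential, and \<open>log\<close> inverts \<open>exp\<close>.\<close>

lemma log_one_plus_mult:
  assumes nil: "\<And>i j. K \<le> i + j \<Longrightarrow> u ^ i * v ^ j = 0"
  shows "log_one_plus scale (u + v + u * v) = log_one_plus scale u + log_one_plus scale v"
proof -
  define x y where "x = fps_eval K u (fps_ln 1)" and "y = fps_eval K v (fps_ln 1)"
  have u: "u ^ K = 0" and v: "v ^ K = 0"
    using nil[of K 0] nil[of 0 K] by simp_all
  \<comment> \<open>The logarithms are multiples of \<open>u\<close> and \<open>v\<close>, so they
    inherit the vanishing of mixed monomials.\<close>
  have "u dvd x" "v dvd y"
    unfolding x_def y_def by (simp_all add: fps_eval_dvd)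
  then have xy: "x ^ i * y ^ j = 0" if "K \<le> i + j" for i j
    using nil[OF that] by (metis dvd_0_left_iff dvd_power_same mult_dvd_mono)
  have nil_add: "(a + b) ^ K = 0" if "\<And>i j. K \<le> i + j \<Longrightarrow> a ^ i * b ^ j = 0" for a b :: 'a
    unfolding binomial_ring using that by (simp add: mult.assoc)
  \<comment> \<open>Writing \<open>u + v + u * v\<close> as a sum of a multiple of \<open>u\<close>
    and a multiple of \<open>v\<close> makes the binomial argument apply.\<close>
  have "(u + v * (1 + u)) ^ K = 0"
    using nil by (intro nil_add) (simp add: power_mult_distrib flip: mult.assoc)
  then have w: "(u + v + u * v) ^ K = 0"
    by (simp add: algebra_simps)
  have exp_x: "fps_eval K x (fps_exp 1) = 1 + u" and exp_y: "fps_eval K y (fps_exp 1) = 1 + v"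
    unfolding x_def y_def
    by (simp_all add: fps_eval_compose[symmetric] fps_exp_oo_ln fps_eval_add fps_eval_1 fps_eval_X u v)
  have xyK: "(x + y) ^ K = 0"
    using xy by (rule nil_add)
  have "fps_eval K (x + y) (fps_exp 1 - 1) = u + v + u * v"
    by (simp add: fps_eval_diff fps_eval_1 fps_eval_exp_add xy xyK exp_x exp_y algebra_simps)
  then have "fps_eval K (u + v + u * v) (fps_ln 1) = fps_eval K (x + y) (fps_ln 1 oo (fps_exp 1 - 1))"
    by (simp add: fps_eval_compose xyK)
  also have "\<dots> = x + y"
    by (simp add: fps_ln_oo_exp fps_eval_X xyK)
  finally show ?thesis
    by (simp add: log_one_plus_eq_fps_eval[OF u] log_one_plus_eq_fps_eval[OF v]
        log_one_plus_eq_fps_eval[OF w] x_def y_def)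
qed

end

section \<open>Gradings given by their projections, and the order filtration\<close>

locale graded_comm_algebra = comm_algebra scale
  for scale :: "'f::field_char_0 \<Rightarrow> 'a::comm_ring_1 \<Rightarrow> 'a" (infixr \<open>*s\<close> 75) +
  fixes part :: "nat \<Rightarrow> 'a \<Rightarrow> 'a" and d :: nat
  assumes part_add: "part n (x + y) = part n x + part n y"
    and part_scale: "part n (c *s x) = c *s part n x"
    and part_part: "part m (part n x) = (if m = n then part n x else 0)"
    and part_mult: "part n (x * y) = (\<Sum>i\<le>n. part i x * part (n - i) y)"
    and part_one: "part n 1 = (if n = 0 then 1 else 0)"
    and sum_part: "(\<Sum>n\<le>d. part n x) = x"
    and part_zero_scalar: "\<exists>c. part 0 x = c *s 1"
begin

lemma part_0 [simp]: "part n 0 = 0"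
  using part_add[of n 0 0] by simp

lemma part_minus: "part n (- x) = - part n x"
  using part_add[of n x "- x"] by (simp add: add_eq_0_iff)

lemma part_diff: "part n (x - y) = part n x - part n y"
  using part_add[of n x "- y"] by (simp add: part_minus)

lemma part_sum: "part n (sum f A) = (\<Sum>a\<in>A. part n (f a))"
  by (induction A rule: infinite_finite_induct) (simp_all add: part_add)

lemma part_eq_0:
  assumes "d < n"
  shows "part n x = 0"
proof -
  have "part n x = (\<Sum>m\<le>d. part n (part m x))"
    by (metis part_sum sum_part)
  then show ?thesis
    using assms by (simp add: part_part)
qed

lemma part_eqI:
  assumes "\<And>n. part n x = part n y"
  shows "x = y"
  by (metis assms sum.cong sum_part)

lemma part_zero_mult: "part 0 (x * y) = part 0 x * part 0 y"
  by (simp add: part_mult)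

lemma part_zero_power: "part 0 (x ^ n) = part 0 x ^ n"
  by (induction n) (simp_all add: part_one part_zero_mult)

text \<open>The order filtration of the grading: it is multiplicative and zero beyond
  \<open>d\<close>. Its first step, the kernel of \<open>part 0\<close>, later turns out to be the
  maximal ideal.\<close>

definition filt :: "nat \<Rightarrow> 'a set" where
  "filt k = {x. \<forall>n<k. part n x = 0}"

lemma filt_zero [simp]: "filt 0 = UNIV"
  by (simp add: filt_def)

lemma mem_filt_1 [simp]: "x \<in> filt (Suc 0) \<longleftrightarrow> part 0 x = 0"
  by (simp add: filt_def)

lemma filt_mono: "k \<le> l \<Longrightarrow> filt l \<subseteq> filt k"
  by (auto simp: filt_def)

lemma filt_add: "x \<in> filt k \<Longrightarrow> y \<in> filt k \<Longrightarrow> x + y \<in> filt k"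
  by (simp add: filt_def part_add)

lemma filt_diff: "x \<in> filt k \<Longrightarrow> y \<in> filt k \<Longrightarrow> x - y \<in> filt k"
  by (simp add: filt_def part_diff)

lemma filt_scale: "x \<in> filt k \<Longrightarrow> c *s x \<in> filt k"
  by (simp add: filt_def part_scale)

lemma filt_mult:
  assumes "x \<in> filt k" "y \<in> filt l"
  shows "x * y \<in> filt (k + l)"
proof -
  have "part i x * part (n - i) y = 0" if "n < k + l" "i \<le> n" for n i
    using assms that by (cases "i < k") (auto simp: filt_def)
  then show ?thesis
    by (simp add: filt_def part_mult)
qed

lemma filt_power: "x \<in> filt k \<Longrightarrow> x ^ n \<in> filt (n * k)"
  by (induction n) (simp_all add: filt_mult)

lemma filt_eq_0:
  assumes "x \<in> filt k" "d < k"
  shows "x = 0"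
proof -
  have "(\<Sum>n\<le>d. part n x) = 0"
    using assms by (intro sum.neutral) (auto simp: filt_def)
  then show ?thesis
    by (simp add: sum_part)
qed

lemma power_mult_power_eq_0:
  assumes "u \<in> filt 1" "v \<in> filt 1" "Suc d \<le> i + j"
  shows "u ^ i * v ^ j = 0"
proof (rule filt_eq_0)
  show "u ^ i * v ^ j \<in> filt (i + j)"
    using filt_mult[OF filt_power[OF assms(1)] filt_power[OF assms(2)]] by simp
qed (use assms in simp)

lemma power_eq_0:
  assumes "u \<in> filt 1"
  shows "u ^ Suc d = 0"
  using power_mult_power_eq_0[OF assms assms, of "Suc d" 0] by simp

text \<open>\<open>1 - w\<close> is nilpotent, so the geometric series in it terminates and inverts
  \<open>w\<close>.\<close>

lemma inverse_exists:
  assumes "part 0 w = 1"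
  shows "\<exists>r. w * r = 1"
proof -
  have "1 - w \<in> filt 1"
    by (simp add: part_diff part_one assms)
  then have "(1 - w) ^ Suc d = 0"
    by (rule power_eq_0)
  then have "1 = (1 - (1 - w)) * (\<Sum>i<Suc d. (1 - w) ^ i)"
    using one_diff_power_eq[of "1 - w" "Suc d"] by simp
  then show ?thesis
    by (metis diff_diff_eq2 add_diff_cancel_left')
qed

section \<open>The Euler derivation and exponentials of derivations\<close>

definition euler :: "'a \<Rightarrow> 'a" where
  "euler x = (\<Sum>n\<le>d. of_nat n *s part n x)"

lemma part_euler: "part n (euler x) = of_nat n *s part n x"
proof -
  have "part n (euler x) = (\<Sum>m\<le>d. if n = m then of_nat n *s part n x else 0)"
    unfolding euler_def part_sum part_scale by (intro sum.cong) (auto simp: part_part)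
  then show ?thesis
    by (simp add: part_eq_0)
qed

lemma euler_add: "euler (x + y) = euler x + euler y"
  by (rule part_eqI) (simp add: part_euler part_add scale_right_distrib)

lemma euler_scale: "euler (c *s x) = c *s euler x"
  by (rule part_eqI) (simp add: part_euler part_scale mult.commute)

text \<open>In degree \<open>n\<close> the factor \<open>n\<close> splits as
  \<open>i + (n - i)\<close> over the two factors.\<close>

lemma euler_mult: "euler (x * y) = euler x * y + x * euler y"
proof (rule part_eqI)
  fix n
  have "part n (euler (x * y)) = (\<Sum>i\<le>n. of_nat n *s (part i x * part (n - i) y))"
    by (simp add: part_euler part_mult scale_sum_right)
  also have "\<dots> = (\<Sum>i\<le>n. of_nat i *s part i x * part (n - i) y
      + part i x * of_nat (n - i) *s part (n - i) y)"
    by (intro sum.cong refl)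
      (simp add: scale_mult_left scale_mult_right of_nat_diff flip: scale_left_distrib)
  also have "\<dots> = part n (euler x * y + x * euler y)"
    by (simp add: part_add part_mult part_euler sum.distrib)
  finally show "part n (euler (x * y)) = part n (euler x * y + x * euler y)" .
qed

lemma euler_filt: "x \<in> filt k \<Longrightarrow> euler x \<in> filt k"
  by (simp add: filt_def part_euler)

text \<open>The exponential series of an operator. The cut-off is exact for operators that raise the
  order in \<open>filt\<close>, as their powers beyond \<open>d\<close> vanish.\<close>

definition op_exp :: "('a \<Rightarrow> 'a) \<Rightarrow> 'a \<Rightarrow> 'a" where
  "op_exp N x = (\<Sum>n<Suc d. (1 / fact n) *s (N ^^ n) x)"

lemma iterate_filt:
  assumes "\<And>j x. x \<in> filt j \<Longrightarrow> N x \<in> filt (j + k)"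
  shows "(N ^^ n) x \<in> filt (n * k)"
proof (induction n)
  case (Suc n)
  then show ?case
    using assms[OF Suc] by (simp add: add.commute)
qed simp

text \<open>Preserving \<open>part 0\<close> keeps \<open>filt 1\<close> stable. Bijectivity is left
  out here; it later follows from compatibility with \<omega>.\<close>

definition augmented_endo :: "('a \<Rightarrow> 'a) \<Rightarrow> bool" where
  "augmented_endo \<phi> \<longleftrightarrow>
     (\<forall>x y. \<phi> (x + y) = \<phi> x + \<phi> y) \<and> (\<forall>c x. \<phi> (c *s x) = c *s \<phi> x) \<and>
     (\<forall>x y. \<phi> (x * y) = \<phi> x * \<phi> y) \<and> \<phi> 1 = 1 \<and> (\<forall>x. part 0 (\<phi> x) = part 0 x)"

text \<open>In the power series \<open>P x = (\<Sum>n. N\<^sup>n x / n! t\<^sup>n)\<close>, applying \<open>N\<close> to the coefficients is the same as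
  differentiating, so the product rule makes \<open>P\<close> multiplicative.\<close>

lemma augmented_endo_op_exp:
  assumes add: "\<And>x y. N (x + y) = N x + N y"
    and scale: "\<And>c x. N (c *s x) = c *s N x"
    and mult: "\<And>x y. N (x * y) = N x * y + x * N y"
    and filt: "\<And>j x. x \<in> filt j \<Longrightarrow> N x \<in> filt (Suc j)"
  shows "augmented_endo (op_exp N)"
proof -
  have filt_pow: "(N ^^ n) x \<in> filt n" for n x
    using iterate_filt[where N = N and k = 1] filt by simp
  have add_pow: "(N ^^ n) (x + y) = (N ^^ n) x + (N ^^ n) y" for n x y
    by (induction n) (simp_all add: add)
  have scale_pow: "(N ^^ n) (c *s x) = c *s (N ^^ n) x" for n c x
    by (induction n) (simp_all add: scale)
  have N0: "N 0 = 0"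
    using add[of 0 0] by simp
  have N_sum: "N (sum f A) = (\<Sum>a\<in>A. N (f a))" for f :: "nat \<Rightarrow> 'a" and A
    by (induction A rule: infinite_finite_induct) (simp_all add: add N0)
  have N1: "N 1 = 0"
    using mult[of 1 1] by simp
  have one_pow: "(N ^^ n) 1 = (if n = 0 then 1 else 0)" for n
    by (induction n) (simp_all add: N0 N1)
  define P where "P x = Abs_fps (\<lambda>n. (1 / fact n) *s (N ^^ n) x)" for x
  have P_nth: "P x $ n = (1 / fact n) *s (N ^^ n) x" for x n
    by (simp add: P_def)
  have N_P: "N (P x $ n) = fps_deriv (P x) $ n" for x n
    by (simp add: P_nth scale of_nat_mult_scale field_simps del: of_nat_Suc)
  have P_mult: "P (x * y) = P x * P y" for x y
  proof (rule fps_ext)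
    fix n
    show "P (x * y) $ n = (P x * P y) $ n"
    proof (induction n)
      case (Suc n)
      have "of_nat (Suc n) * P (x * y) $ Suc n = N (P (x * y) $ n)"
        by (simp add: N_P)
      also have "\<dots> = (\<Sum>i=0..n. N (P x $ i) * P y $ (n - i) + P x $ i * N (P y $ (n - i)))"
        by (simp add: Suc fps_mult_nth N_sum mult)
      also have "\<dots> = fps_deriv (P x * P y) $ n"
        unfolding fps_deriv_mult fps_add_nth fps_mult_nth[of _ "fps_deriv _"]
          fps_mult_nth[of "fps_deriv _"] N_P
        by (simp add: sum.distrib)
      also have "\<dots> = of_nat (Suc n) * (P x * P y) $ Suc n"
        by (simp only: fps_deriv_nth Suc_eq_plus1)
      finally have "of_nat (Suc n) *s P (x * y) $ Suc n = of_nat (Suc n) *s (P x * P y) $ Suc n"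
        by (simp only: of_nat_mult_scale)
      \<comment> \<open>Characteristic zero allows the factor \<open>Suc n\<close> to be
        cancelled.\<close>
      then show ?case
        by (metis of_nat_neq_0 scale_left_imp_eq)
    qed (simp add: P_nth)
  qed
  have op_exp_P: "op_exp N x = (\<Sum>n<Suc d. P x $ n)" for x
    by (simp add: op_exp_def P_nth)
  have "op_exp N (x + y) = op_exp N x + op_exp N y" for x y
    by (simp add: op_exp_def add_pow scale_right_distrib sum.distrib del: sum.lessThan_Suc)
  moreover have "op_exp N (c *s x) = c *s op_exp N x" for c x
    by (simp add: op_exp_def scale_pow scale_sum_right mult.commute del: sum.lessThan_Suc)
  moreover have "op_exp N (x * y) = op_exp N x * op_exp N y" for x y
  proof -
    have "op_exp N x * op_exp N y = (\<Sum>n<Suc d. \<Sum>i\<le>n. P x $ i * P y $ (n - i))"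
      unfolding op_exp_P
    proof (rule sum_mult_sum_triangle)
      \<comment> \<open>The coefficient of index \<open>i\<close> has order at least
        \<open>i\<close>, so these products have order above \<open>d\<close>.\<close>
      fix i j assume "Suc d \<le> i + j"
      moreover have "P x $ i * P y $ j \<in> filt (i + j)"
        by (simp add: P_nth filt_mult filt_scale filt_pow)
      ultimately show "P x $ i * P y $ j = 0"
        using filt_eq_0 Suc_le_lessD by blast
    qed
    then show ?thesis
      by (simp only: op_exp_P P_mult fps_mult_nth atLeast0AtMost)
  qed
  moreover have "op_exp N 1 = 1"
    by (simp add: op_exp_def one_pow if_distrib[of "scale _"] sum.lessThan_Suc_shift del: sum.lessThan_Suc)
  moreover have "part 0 (op_exp N x) = part 0 x" for x
  proof -
    have "part 0 ((N ^^ Suc n) x) = 0" for n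
      using filt_pow[of "Suc n" x] unfolding filt_def by blast
    then show ?thesis
      by (simp add: op_exp_def part_add part_sum part_scale sum.lessThan_Suc_shift del: sum.lessThan_Suc funpow.simps)
  qed
  ultimately show ?thesis
    by (simp add: augmented_endo_def)
qed

lemma augmented_endo_id: "augmented_endo (\<lambda>x. x)"
  by (simp add: augmented_endo_def)

lemma augmented_endo_comp:
  "augmented_endo \<phi> \<Longrightarrow> augmented_endo \<psi> \<Longrightarrow> augmented_endo (\<lambda>x. \<phi> (\<psi> x))"
  by (simp add: augmented_endo_def)

lemma augmented_endo_log:
  assumes "augmented_endo \<phi>" "u \<in> filt 1"
  shows "\<phi> (log_one_plus scale u) = log_one_plus scale (\<phi> u)"
proof -
  have \<phi>: "\<phi> (x + y) = \<phi> x + \<phi> y" "\<phi> (c *s x) = c *s \<phi> x" "\<phi> (x * y) = \<phi> x * \<phi> y"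
    "\<phi> 1 = 1" "part 0 (\<phi> x) = part 0 x" for x y c
    using assms(1) unfolding augmented_endo_def by auto
  have \<phi>0: "\<phi> 0 = 0"
    using \<phi>(1)[of 0 0] by simp
  have \<phi>_sum: "\<phi> (sum f A) = (\<Sum>a\<in>A. \<phi> (f a))" for f :: "nat \<Rightarrow> 'a" and A
    by (induction A rule: infinite_finite_induct) (simp_all add: \<phi> \<phi>0)
  have \<phi>_power: "\<phi> (x ^ n) = \<phi> x ^ n" for x n
    by (induction n) (simp_all add: \<phi>)
  have "\<phi> u \<in> filt 1"
    using assms(2) by (simp add: \<phi>)
  then show ?thesis
    using assms(2)
    by (simp add: log_one_plus_eq_fps_eval[OF power_eq_0] fps_eval_def \<phi>_sum \<phi>_power \<phi> del: sum.lessThan_Suc)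
qed

lemma log_filt:
  assumes "u \<in> filt 1"
  shows "log_one_plus scale u \<in> filt 1"
proof -
  have "u dvd log_one_plus scale u"
    unfolding log_one_plus_eq_fps_eval[OF power_eq_0[OF assms]] by (rule fps_eval_dvd) simp
  then show ?thesis
    using assms by (auto simp: dvd_def part_zero_mult)
qed

end

section \<open>The nondegenerate form defined by the top coordinate\<close>

locale graded_frobenius_algebra = graded_comm_algebra scale part d
  for scale :: "'f::field_char_0 \<Rightarrow> 'a::comm_ring_1 \<Rightarrow> 'a" (infixr \<open>*s\<close> 75) and part d +
  fixes e :: 'a and \<omega> :: "'a \<Rightarrow> 'f"
  assumes part_top: "part d x = \<omega> x *s e"
    and e_nonzero: "e \<noteq> 0"
    and top_positive: "0 < d"
    and nondegenerate: "(\<And>y. \<omega> (x * y) = 0) \<Longrightarrow> x = 0"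
    and finite_dim: "\<exists>B. finite B \<and> span B = UNIV"
begin

lemma functional_eqI: "part d x = c *s e \<Longrightarrow> \<omega> x = c"
  using part_top e_nonzero by (metis scale_right_imp_eq)

lemma functional_add: "\<omega> (x + y) = \<omega> x + \<omega> y"
  by (rule functional_eqI) (simp add: part_add part_top scale_left_distrib)

lemma functional_scale: "\<omega> (c *s x) = c * \<omega> x"
  by (rule functional_eqI) (simp add: part_scale part_top)

lemma functional_0 [simp]: "\<omega> 0 = 0"
  by (rule functional_eqI) simp

lemma functional_1 [simp]: "\<omega> 1 = 0"
  by (rule functional_eqI) (use top_positive in \<open>simp add: part_one\<close>)

lemma functional_diff: "\<omega> (x - y) = \<omega> x - \<omega> y"
  by (metis add_diff_cancel_right' diff_add_cancel functional_add)

lemma functional_sum: "\<omega> (sum f A) = (\<Sum>a\<in>A. \<omega> (f a))"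
  by (induction A rule: infinite_finite_induct) (simp_all add: functional_add)

lemma functional_euler: "\<omega> (euler x) = of_nat d * \<omega> x"
  by (rule functional_eqI) (simp add: part_euler part_top)

lemma linear_inj_imp_surj:
  assumes "Vector_Spaces.linear scale scale f" "\<And>x. f x = 0 \<Longrightarrow> x = 0"
  shows "surj f"
proof -
  obtain B where "independent B" "span B = UNIV"
    using basis_exists[of UNIV] by (metis top.extremum_uniqueI)
  moreover from this have "finite B"
    using finite_dim independent_span_bound by (metis subset_UNIV)
  ultimately interpret fd: finite_dimensional_vector_space scale B
    by unfold_locales
  interpret f: Vector_Spaces.linear scale scale f
    by fact
  show ?thesis
    using assms f.inj_iff_eq_0 by (intro fd.linear_inj_imp_surj) auto
qed

text \<open>\<open>T g\<close> encodes the values of \<open>\<omega> (g * b)\<close> on a basis as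
  one element of the algebra. Nondegeneracy makes \<open>T\<close> injective, finite dimension makes
  it surjective, and a preimage of the values of \<mu> is the desired \<open>g\<close>.\<close>

lemma functional_represented:
  assumes add: "\<And>x y. \<mu> (x + y) = \<mu> x + \<mu> y" and scale: "\<And>c x. \<mu> (c *s x) = c * \<mu> x"
  obtains g where "\<And>x. \<omega> (g * x) = \<mu> x"
proof -
  obtain B where B: "independent B" "span B = UNIV"
    using basis_exists[of UNIV] by (metis top.extremum_uniqueI)
  then have fin: "finite B"
    using finite_dim independent_span_bound by (metis subset_UNIV)
  define T where "T g = (\<Sum>b\<in>B. \<omega> (g * b) *s b)" for g
  have coeffs: "a b = a' b" if "(\<Sum>b\<in>B. a b *s b) = (\<Sum>b\<in>B. a' b *s b)" "b \<in> B" for a a' b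
  proof -
    have "(\<Sum>b\<in>B. (a b - a' b) *s b) = 0"
      using that(1) by (simp add: scale_left_diff_distrib sum_subtractf)
    then show ?thesis
      using independentD[OF B(1) fin order_refl, of "\<lambda>b. a b - a' b" b] that(2) by simp
  qed
  have eq_on_basis: "\<omega> (g * x) = \<nu> x"
    if "\<And>b. b \<in> B \<Longrightarrow> \<omega> (g * b) = \<nu> b"
      and "\<And>x y. \<nu> (x + y) = \<nu> x + \<nu> y" "\<And>c x. \<nu> (c *s x) = c * \<nu> x"
    for g \<nu> x
  proof -
    have "x \<in> span B"
      using B by simp
    then show ?thesis
    proof (induction rule: span_induct_alt)
      case base
      then show ?case
        using that(3)[of 0 0] by simp
    qed (simp add: that distrib_left functional_add functional_scale scale_mult_right)
  qed
  have "surj T"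
  proof (rule linear_inj_imp_surj)
    show "Vector_Spaces.linear scale scale T"
      by unfold_locales (simp_all add: T_def distrib_right functional_add scale_mult_left
          functional_scale scale_left_distrib sum.distrib scale_sum_right)
    show "g = 0" if "T g = 0" for g
    proof (rule nondegenerate)
      have "\<omega> (g * b) = 0" if "b \<in> B" for b
        using coeffs[of "\<lambda>b. \<omega> (g * b)" "\<lambda>_. 0"] \<open>T g = 0\<close> that by (simp add: T_def)
      then show "\<omega> (g * y) = 0" for y
        by (rule eq_on_basis) simp_all
    qed
  qed
  then obtain g where "T g = (\<Sum>b\<in>B. \<mu> b *s b)"
    by (metis surjD)
  then have "\<omega> (g * b) = \<mu> b" if "b \<in> B" for b
    using coeffs[of "\<lambda>b. \<omega> (g * b)" \<mu> b] that by (simp add: T_def)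
  then have "\<omega> (g * x) = \<mu> x" for x
    by (rule eq_on_basis) (simp_all add: add scale)
  then show thesis
    by (rule that)
qed

text \<open>The adjoint of \<open>N ^^ n\<close> is \<open>T ^^ n\<close>, and both exponentials
  have the same coefficients.\<close>

lemma op_exp_adjoint:
  assumes "\<And>y z. \<omega> (N y * z) = \<omega> (y * T z)"
  shows "\<omega> (op_exp N y * z) = \<omega> (y * op_exp T z)"
proof -
  have "\<omega> ((N ^^ n) y * z) = \<omega> (y * (T ^^ n) z)" for n y z
  proof (induction n arbitrary: z)
    case (Suc n)
    then show ?case
      by (simp add: assms funpow_swap1[of T])
  qed simp
  then show ?thesis
    by (simp add: op_exp_def sum_distrib_right sum_distrib_left functional_sum scale_mult_left
        scale_mult_right functional_scale del: sum.lessThan_Suc)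
qed

text \<open>Moser's method, one degree at a time: if \<open>h\<close> is the part of \<open>g - 1\<close> of lowest degree \<open>k\<close>, then
  the exponential of the derivation \<open>a D\<close>, where \<open>D\<close> is the Euler derivation and
  \<open>a = - h / (d - k)\<close>, moves \<open>g - 1\<close> to degree \<open>k + 1\<close>. Since \<open>\<omega> \<circ> D = d \<omega>\<close>, the adjoint of
  \<open>a D\<close> with respect to \<open>\<omega>\<close> is \<open>z \<mapsto> (d - D) (a z)\<close>.\<close>

lemma augmented_endo_exists:
  assumes "part 0 g = 1" "\<omega> g = 0"
  shows "\<exists>\<phi>. augmented_endo \<phi> \<and> (\<forall>y. \<omega> (g * \<phi> y) = \<omega> y)"
proof -
  have "\<forall>g. g - 1 \<in> filt 1 \<and> \<omega> g = 0 \<longrightarrow>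
      (\<exists>\<phi>. augmented_endo \<phi> \<and> (\<forall>y. \<omega> (g * \<phi> y) = \<omega> y))"
  \<comment> \<open>Descending induction on the order of \<open>g - 1\<close>.\<close>
  proof (rule inc_induct[of 1 d])
    show "1 \<le> d"
      using top_positive by simp
    show "\<forall>g. g - 1 \<in> filt d \<and> \<omega> g = 0 \<longrightarrow>
      (\<exists>\<phi>. augmented_endo \<phi> \<and> (\<forall>y. \<omega> (g * \<phi> y) = \<omega> y))"
    proof (intro allI impI)
      fix g assume g: "g - 1 \<in> filt d \<and> \<omega> g = 0"
      \<comment> \<open>Both \<open>g\<close> and \<open>1\<close> have top coordinate zero, so
        \<open>g - 1\<close> has order above \<open>d\<close> and vanishes.\<close>
      then have "part d (g - 1) = 0"
        by (simp add: part_top functional_diff)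
      with g have "g - 1 \<in> filt (Suc d)"
        by (simp add: filt_def less_Suc_eq)
      then have "g - 1 = 0"
        by (rule filt_eq_0) simp
      then have "g = 1"
        by simp
      then show "\<exists>\<phi>. augmented_endo \<phi> \<and> (\<forall>y. \<omega> (g * \<phi> y) = \<omega> y)"
        using augmented_endo_id by auto
    qed
  next
    fix k
    assume k: "1 \<le> k" "k < d"
      and IH: "\<forall>g. g - 1 \<in> filt (Suc k) \<and> \<omega> g = 0 \<longrightarrow>
        (\<exists>\<phi>. augmented_endo \<phi> \<and> (\<forall>y. \<omega> (g * \<phi> y) = \<omega> y))"
    show "\<forall>g. g - 1 \<in> filt k \<and> \<omega> g = 0 \<longrightarrow>
        (\<exists>\<phi>. augmented_endo \<phi> \<and> (\<forall>y. \<omega> (g * \<phi> y) = \<omega> y))"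
    proof (intro allI impI)
      fix g assume "g - 1 \<in> filt k \<and> \<omega> g = 0"
      then have g: "g - 1 \<in> filt k" "\<omega> g = 0"
        by auto
      define a where "a = (- 1 / of_nat (d - k)) *s part k g"
      define N where "N y = a * euler y" for y
      define T where "T z = of_nat d *s (a * z) - euler (a * z)" for z
      have a_filt: "a \<in> filt k"
        using k by (auto simp: a_def filt_def part_scale part_part part_minus)
      have part0_g: "part 0 g = 1"
        using g(1) k by (simp add: filt_def part_diff part_one)
      have N_filt: "N x \<in> filt (Suc j)" if "x \<in> filt j" for j x
        using filt_mult[OF a_filt euler_filt[OF that]] filt_mono[of "Suc j" "k + j"] k(1)
        by (auto simp: N_def)
      have T_filt: "T z \<in> filt (j + k)" if "z \<in> filt j" for j z
        using filt_mult[OF that a_filt]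
        by (simp add: T_def filt_diff filt_scale euler_filt mult.commute)
      have endo: "augmented_endo (op_exp N)"
        by (rule augmented_endo_op_exp)
          (simp_all add: N_def euler_add euler_scale euler_mult scale_mult_right algebra_simps
            N_filt[unfolded N_def])
      have adjoint: "\<omega> (N y * z) = \<omega> (y * T z)" for y z
      proof -
        \<comment> \<open>Integration by parts: the product rule moves the Euler derivation from
          \<open>y\<close> to \<open>a * z\<close>, and \<omega> of the total derivative is
          \<open>d\<close> times \<omega>.\<close>
        have "N y * z = euler (y * (a * z)) - y * euler (a * z)"
          by (simp add: N_def euler_mult algebra_simps)
        then show ?thesis
          by (simp add: T_def functional_diff functional_euler functional_scale scale_mult_right
              right_diff_distrib)
      qed
      define g' where "g' = op_exp T g"
      have g'_adjoint: "\<omega> (g * op_exp N y) = \<omega> (g' * y)" for y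
        using op_exp_adjoint[OF adjoint, of y g] by (simp add: g'_def mult.commute)
      have "g' - 1 \<in> filt (Suc k)"
      proof -
        \<comment> \<open>The exponential is split into its constant term, its linear term and the
          rest; \<open>0 < d\<close> ensures that the linear term survives the cut-off.\<close>
        have "g' = g + (\<Sum>n<d. (1 / fact (Suc n)) *s (T ^^ Suc n) g)"
          by (simp add: g'_def op_exp_def sum.lessThan_Suc_shift del: sum.lessThan_Suc funpow.simps fact_Suc)
        also obtain d' where "d = Suc d'"
          using top_positive by (cases d) auto
        then have "(\<Sum>n<d. (1 / fact (Suc n)) *s (T ^^ Suc n) g)
            = T g + (\<Sum>n<d'. (1 / fact (Suc (Suc n))) *s (T ^^ Suc (Suc n)) g)"
          by (simp add: sum.lessThan_Suc_shift del: sum.lessThan_Suc funpow.simps fact_Suc) simp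
        finally have g'_eq: "g' - 1 = (g - 1 + T g)
            + (\<Sum>n<d'. (1 / fact (Suc (Suc n))) *s (T ^^ Suc (Suc n)) g)"
          by simp
        have "(\<Sum>n\<in>A. (1 / fact (Suc (Suc n))) *s (T ^^ Suc (Suc n)) g) \<in> filt (Suc k)" if "finite A" for A
          using that
        proof (induction A)
          case (insert n A)
          have "(T ^^ Suc (Suc n)) g \<in> filt (Suc (Suc n) * k)"
            by (rule iterate_filt) (rule T_filt)
          \<comment> \<open>Since \<open>k \<ge> 1\<close>, applying \<open>T\<close> at least twice
            raises the order to at least \<open>2 * k\<close>, beyond \<open>k\<close>.\<close>
          moreover have "Suc k \<le> Suc (Suc n) * k"
            using k(1) by simp
          ultimately have "(T ^^ Suc (Suc n)) g \<in> filt (Suc k)"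
            using filt_mono by blast
          with insert show ?case
            by (simp add: filt_add filt_scale del: funpow.simps fact_Suc)
        qed (simp add: filt_def)
        moreover have "g - 1 + T g \<in> filt (Suc k)"
        proof -
          have "g - 1 + T g \<in> filt k"
            using g(1) T_filt[of g 0] by (simp add: filt_add)
          moreover have "part k (g - 1 + T g) = 0"
          proof -
            \<comment> \<open>\<open>a\<close> is homogeneous of degree \<open>k\<close> and
              \<open>g\<close> has scalar part \<open>1\<close>.\<close>
            have "part k (a * g) = (\<Sum>i\<le>k. if i = k then a else 0)"
              unfolding part_mult
            proof (rule sum.cong[OF refl])
              fix i assume "i \<in> {..k}"
              then show "part i a * part (k - i) g = (if i = k then a else 0)"
                by (simp add: a_def part_scale part_part part_minus part0_g)
            qed
            then have "part k (a * g) = a"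
              by simp
            \<comment> \<open>The denominator \<open>d - k\<close> in \<open>a\<close> was chosen to
              cancel this factor, so \<open>T g\<close> removes exactly the degree \<open>k\<close>
              part of \<open>g\<close>.\<close>
            then have "part k (T g) = (of_nat d - of_nat k) *s a"
              by (simp add: T_def part_diff part_scale part_euler scale_left_diff_distrib)
            also have "\<dots> = - part k g"
              using k(2) by (simp add: a_def of_nat_diff field_simps)
            finally show ?thesis
              using k(1) by (simp add: part_add part_diff part_one)
          qed
          ultimately show ?thesis
            by (simp add: filt_def less_Suc_eq)
        qed
        ultimately show ?thesis
          unfolding g'_eq by (simp add: filt_add)
      qed
      \<comment> \<open>The adjoint identity at \<open>y = 1\<close>, where
        \<open>op_exp N 1 = 1\<close>.\<close>
      moreover have "\<omega> g' = 0"
        using g'_adjoint[of 1] endo g(2) by (simp add: augmented_endo_def)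
      ultimately obtain \<phi> where \<phi>: "augmented_endo \<phi>" "\<And>y. \<omega> (g' * \<phi> y) = \<omega> y"
        using IH by blast
      then have "\<omega> (g * op_exp N (\<phi> y)) = \<omega> y" for y
        by (simp add: g'_adjoint)
      with augmented_endo_comp[OF endo \<phi>(1)]
      show "\<exists>\<phi>. augmented_endo \<phi> \<and> (\<forall>y. \<omega> (g * \<phi> y) = \<omega> y)"
        by blast
    qed
  qed
  moreover have "g - 1 \<in> filt 1"
    using assms(1) by (simp add: part_diff part_one)
  ultimately show ?thesis
    using assms(2) by blast
qed

text \<open>Applying the hypothesis to \<open>x * y\<close> gives
  \<open>\<omega> (x * y) = \<omega> (g * (\<phi> x * \<phi> y))\<close>, so the kernel of \<phi>
  lies in the radical of the form, which is zero. Finite dimension then gives surjectivity.\<close>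

lemma bij_augmented_endo:
  assumes \<phi>: "augmented_endo \<phi>" and g: "\<And>y. \<omega> (g * \<phi> y) = \<omega> y"
  shows "bij \<phi>"
proof -
  have "x = 0" if "\<phi> x = 0" for x
  proof (rule nondegenerate)
    fix y
    have "\<omega> (x * y) = \<omega> (g * (\<phi> x * \<phi> y))"
      using g[of "x * y"] \<phi> by (simp add: augmented_endo_def)
    with that show "\<omega> (x * y) = 0"
      by simp
  qed
  moreover have lin: "Vector_Spaces.linear scale scale \<phi>"
    by unfold_locales (use \<phi> in \<open>auto simp: augmented_endo_def\<close>)
  moreover have "inj \<phi>"
  proof -
    interpret f: Vector_Spaces.linear scale scale \<phi> by fact
    show ?thesis
      using calculation(1) f.inj_iff_eq_0 by auto
  qed
  ultimately show ?thesis
    using linear_inj_imp_surj by (auto simp: bij_def)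
qed

section \<open>Affine maps between the hypersurfaces of logarithms\<close>

definition log_quadric :: "'a \<Rightarrow> 'a set" where
  "log_quadric g = log_one_plus scale ` {u \<in> filt 1. \<omega> (g * (1 + u)\<^sup>2) = 0}"

lemma log_mult:
  "u \<in> filt 1 \<Longrightarrow> v \<in> filt 1 \<Longrightarrow>
    log_one_plus scale (u + v + u * v) = log_one_plus scale u + log_one_plus scale v"
  by (rule log_one_plus_mult[of "Suc d"]) (rule power_mult_power_eq_0)

text \<open>The translation \<open>p\<close> may be any point of the target, so comparing the maps
  for two points yields transitivity.\<close>

lemma affine_map_from_standard_log_quadric:
  assumes g: "part 0 g = 1" and p: "p \<in> log_quadric g"
  shows "\<exists>\<phi>. augmented_endo \<phi> \<and> bij \<phi> \<and> (\<lambda>x. \<phi> x + p) ` log_quadric 1 = log_quadric g"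
proof -
  obtain v where v: "v \<in> filt 1" "\<omega> (g * (1 + v)\<^sup>2) = 0" and p_eq: "p = log_one_plus scale v"
    using p by (auto simp: log_quadric_def)
  have v0: "part 0 v = 0"
    using v(1) by simp
  have "part 0 (g * (1 + v)\<^sup>2) = 1"
    by (simp add: part_zero_mult part_zero_power part_add part_one g v0)
  with v(2) obtain \<phi> where \<phi>: "augmented_endo \<phi>" and eq: "\<And>y. \<omega> (g * (1 + v)\<^sup>2 * \<phi> y) = \<omega> y"
    using augmented_endo_exists by blast
  have bij: "bij \<phi>"
    using \<phi> eq by (rule bij_augmented_endo)
  have part0: "part 0 (\<phi> x) = part 0 x" for x
    using \<phi> by (simp add: augmented_endo_def)
  have shift: "\<phi> (log_one_plus scale u) + p = log_one_plus scale (\<phi> u + v + \<phi> u * v)"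
      "\<omega> (g * (1 + (\<phi> u + v + \<phi> u * v))\<^sup>2) = \<omega> ((1 + u)\<^sup>2)"
    if "u \<in> filt 1" for u
  proof -
    show "\<phi> (log_one_plus scale u) + p = log_one_plus scale (\<phi> u + v + \<phi> u * v)"
      using that v by (simp add: log_mult augmented_endo_log[OF \<phi>] p_eq part0)
    have "1 + (\<phi> u + v + \<phi> u * v) = (1 + v) * (1 + \<phi> u)"
      by (simp add: algebra_simps)
    moreover have "\<phi> ((1 + u)\<^sup>2) = (1 + \<phi> u)\<^sup>2"
      using \<phi> by (simp add: augmented_endo_def power2_eq_square)
    ultimately show "\<omega> (g * (1 + (\<phi> u + v + \<phi> u * v))\<^sup>2) = \<omega> ((1 + u)\<^sup>2)"
      using eq[of "(1 + u)\<^sup>2"] by (simp add: power_mult_distrib mult.assoc)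
  qed
  have "(\<lambda>x. \<phi> x + p) ` log_quadric 1 = log_quadric g"
  proof (intro equalityI subsetI)
    fix x assume "x \<in> (\<lambda>x. \<phi> x + p) ` log_quadric 1"
    then obtain u where u: "u \<in> filt 1" "\<omega> ((1 + u)\<^sup>2) = 0" "x = \<phi> (log_one_plus scale u) + p"
      by (auto simp: log_quadric_def)
    have "\<phi> u + v + \<phi> u * v \<in> filt 1"
      using u(1) v0 by (simp add: part_add part_zero_mult part0)
    then show "x \<in> log_quadric g"
      unfolding log_quadric_def u(3) using shift[OF u(1)] u(2) by auto
  next
    fix x assume "x \<in> log_quadric g"
    then obtain w where w: "w \<in> filt 1" "\<omega> (g * (1 + w)\<^sup>2) = 0" "x = log_one_plus scale w"
      by (auto simp: log_quadric_def)
    \<comment> \<open>To reach \<open>log_one_plus scale w\<close>, the equation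
      \<open>(1 + v) * (1 + \<phi> u) = 1 + w\<close> is solved for \<open>u\<close>: first
      \<open>1 + v\<close> is inverted, then \<phi>.\<close>
    obtain r where r: "(1 + v) * r = 1"
      using inverse_exists[of "1 + v"] v0 by (auto simp: part_add part_one)
    have "part 0 ((1 + v) * r) = 1"
      unfolding r by (simp add: part_one)
    then have r0: "part 0 r = 1"
      by (simp add: part_zero_mult part_add part_one v0)
    obtain u where u: "\<phi> u = (1 + w) * r - 1"
      using bij by (metis bij_pointE)
    have "part 0 (\<phi> u) = 0"
      using w(1) by (simp add: u part_diff part_zero_mult part_add part_one r0)
    then have u_filt: "u \<in> filt 1"
      by (simp add: part0)
    have "1 + (\<phi> u + v + \<phi> u * v) = (1 + v) * (1 + \<phi> u)"
      by (simp add: algebra_simps)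
    also have "\<dots> = ((1 + v) * r) * (1 + w)"
      unfolding u by (simp add: algebra_simps)
    finally have w_eq: "\<phi> u + v + \<phi> u * v = w"
      by (simp add: r)
    have "log_one_plus scale u \<in> log_quadric 1"
      unfolding log_quadric_def using shift(2)[OF u_filt] u_filt w(2) by (auto simp: w_eq)
    moreover have "x = \<phi> (log_one_plus scale u) + p"
      using shift(1)[OF u_filt] by (simp add: w_eq w(3))
    ultimately show "x \<in> (\<lambda>x. \<phi> x + p) ` log_quadric 1"
      by blast
  qed
  with \<phi> bij show ?thesis
    by blast
qed

lemma augmented_endo_compose_inv:
  assumes \<phi>: "augmented_endo \<phi>" "bij \<phi>" and \<psi>: "augmented_endo \<psi>"
  shows "augmented_endo (\<lambda>x. \<psi> (inv \<phi> x))"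
proof -
  have \<phi>_inv: "\<phi> (inv \<phi> x) = x" for x
    using \<phi>(2) by (simp add: bij_is_surj surj_f_inv_f)
  have inv_eqI: "inv \<phi> x = y" if "\<phi> y = x" for x y
    using \<phi>(2) that by (metis bij_inv_eq_iff)
  have "augmented_endo (inv \<phi>)"
    unfolding augmented_endo_def
    using \<phi>(1) by (auto intro!: inv_eqI simp: augmented_endo_def \<phi>_inv) (metis \<phi>_inv)
  then show ?thesis
    using \<psi> by (rule augmented_endo_comp[rotated])
qed

lemma affine_homogeneous_log_quadric:
  assumes g: "part 0 g = 1"
  shows "affine_homogeneous scale (filt 1) (log_quadric g)"
  unfolding affine_homogeneous_def
proof (intro conjI ballI)
  show subset: "log_quadric g \<subseteq> filt 1"
    by (auto simp only: log_quadric_def log_filt)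
  fix p q assume p: "p \<in> log_quadric g" and q: "q \<in> log_quadric g"
  obtain \<phi> where \<phi>: "augmented_endo \<phi>" "bij \<phi>" "(\<lambda>x. \<phi> x + p) ` log_quadric 1 = log_quadric g"
    using affine_map_from_standard_log_quadric[OF g p] by blast
  obtain \<psi> where \<psi>: "augmented_endo \<psi>" "bij \<psi>" "(\<lambda>x. \<psi> x + q) ` log_quadric 1 = log_quadric g"
    using affine_map_from_standard_log_quadric[OF g q] by blast
  define \<chi> where "\<chi> x = \<psi> (inv \<phi> x)" for x
  have \<chi>: "augmented_endo \<chi>"
    unfolding \<chi>_def by (rule augmented_endo_compose_inv) fact+
  have \<chi>_add: "\<chi> (x + y) = \<chi> x + \<chi> y" and \<chi>_scale: "\<chi> (c *s x) = c *s \<chi> x"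
    and \<chi>_part: "part 0 (\<chi> x) = part 0 x" for x y c
    using \<chi> by (auto simp: augmented_endo_def)
  have \<chi>_0: "\<chi> 0 = 0"
    using \<chi>_add[of 0 0] by simp
  have \<chi>_\<phi>: "\<chi> (\<phi> x) = \<psi> x" for x
    using \<phi>(2) by (simp add: \<chi>_def bij_is_inj)
  have \<chi>_diff: "\<chi> (x - y) = \<chi> x - \<chi> y" for x y
    by (metis \<chi>_add add_diff_cancel_right' diff_add_cancel)
  have bij_\<chi>: "bij \<chi>"
    using bij_comp[OF bij_imp_bij_inv[OF \<phi>(2)] \<psi>(2)] by (simp add: \<chi>_def[abs_def] comp_def)
  have p0: "part 0 p = 0" and q0: "part 0 q = 0"
    using subset p q by auto
  show "\<exists>f. affine_map_on scale (filt 1) f \<and> bij_betw f (filt 1) (filt 1) \<and>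
      f ` log_quadric g = log_quadric g \<and> f p = q"
  proof (intro exI conjI)
    \<comment> \<open>As \<open>\<chi> (\<phi> x) = \<psi> x\<close>, this map sends
      \<open>\<phi> x + p\<close> to \<open>\<psi> x + q\<close>; both expressions parametrise
      \<open>log_quadric g\<close> by \<open>log_quadric 1\<close>.\<close>
    let ?f = "\<lambda>x. \<chi> x + (q - \<chi> p)"
    show "affine_map_on scale (filt 1) ?f"
      unfolding affine_map_on_def linear_map_on_def
      by (intro exI[of _ \<chi>] conjI bexI[of _ "q - \<chi> p"])
        (auto simp: \<chi>_add \<chi>_scale \<chi>_part part_diff p0 q0)
    show "bij_betw ?f (filt 1) (filt 1)"
    proof (rule bij_betw_imageI)
      show "inj_on ?f (filt 1)"
        using bij_\<chi> by (auto simp: inj_on_def bij_def)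
      show "?f ` filt 1 = filt 1"
      proof (intro equalityI subsetI)
        fix y assume y: "y \<in> filt 1"
        obtain x where x: "\<chi> x = y - (q - \<chi> p)"
          using bij_\<chi> by (metis bij_pointE)
        then have "part 0 x = 0"
          using y \<chi>_part[of x] \<chi>_part[of p] by (simp add: part_diff p0 q0)
        with x show "y \<in> ?f ` filt 1"
          by (intro image_eqI[of _ _ x]) simp_all
      qed (auto simp: \<chi>_part part_add part_diff p0 q0)
    qed
    have "?f ` log_quadric g = (\<lambda>x. ?f (\<phi> x + p)) ` log_quadric 1"
      by (simp add: image_image flip: \<phi>(3))
    also have "\<dots> = log_quadric g"
      unfolding \<psi>(3)[symmetric] by (simp add: \<chi>_add \<chi>_\<phi>)
    finally show "?f ` log_quadric g = log_quadric g" .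
    show "\<chi> p + (q - \<chi> p) = q"
      by simp
  qed
qed

end

section \<open>From graded Gorenstein algebras to the nondegenerate form\<close>

lemma (in comm_algebra) graded_algebraE:
  assumes finite_dim: "\<exists>B. finite B \<and> span B = UNIV" and graded: "graded_algebra scale"
  obtains part d where "graded_comm_algebra scale part d" "\<exists>x. part d x \<noteq> 0"
proof -
  obtain A :: "nat \<Rightarrow> 'a set" and \<phi> where sub: "\<And>j. subspace (A j)"
    and dec: "\<And>x. \<exists>!c. (\<forall>j. c j \<in> A j) \<and> finite {j. c j \<noteq> 0} \<and> x = Sum_any c"
    and mult: "\<And>j k x y. x \<in> A j \<Longrightarrow> y \<in> A k \<Longrightarrow> x * y \<in> A (j + k)"
    and \<phi>: "Vector_Spaces.linear (*) scale \<phi>" "bij_betw \<phi> UNIV (A 0)"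
    using graded unfolding graded_algebra_def by blast
  define P where "P x c \<longleftrightarrow> (\<forall>j. c j \<in> A j) \<and> finite {j. c j \<noteq> 0} \<and> x = Sum_any c" for x c
  \<comment> \<open>By uniqueness of decompositions, identities for \<open>part\<close> are proved
    below by exhibiting a decomposition.\<close>
  define part where "part n x = (THE c. P x c) n" for n x
  have ex1: "\<exists>!c. P x c" for x
    using dec unfolding P_def .
  have P_part: "P x (\<lambda>n. part n x)" for x
    using theI'[OF ex1[of x]] by (simp add: part_def[abs_def])
  have part_eqI: "part n x = c n" if "P x c" for x c n
    unfolding part_def using the1_equality[of "P x" c] ex1 that by simp
  have part_mem: "part n x \<in> A n" and fin: "finite {n. part n x \<noteq> 0}" for n x
    using P_part[of x] by (auto simp: P_def)
  have part_add: "part n (x + y) = part n x + part n y" for n x y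
  proof (rule part_eqI)
    have "finite {n. part n x + part n y \<noteq> 0}"
      by (rule finite_subset[OF _ finite_UnI[OF fin[of x] fin[of y]]]) auto
    moreover have "x + y = (\<Sum>n. part n x + part n y)"
      using P_part[of x] P_part[of y] fin by (simp add: Sum_any.distrib P_def)
    ultimately show "P (x + y) (\<lambda>n. part n x + part n y)"
      by (simp add: P_def subspace_add sub part_mem)
  qed
  have part_scale: "part n (c *s x) = c *s part n x" for n c x
  proof (rule part_eqI)
    have f: "finite {n. c *s part n x \<noteq> 0}"
      by (rule finite_subset[OF _ fin[of x]]) auto
    have "x = (\<Sum>n | part n x \<noteq> 0. part n x)"
      using P_part[of x] by (simp add: P_def Sum_any.expand_set)
    then have "c *s x = (\<Sum>n | part n x \<noteq> 0. c *s part n x)"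
      by (metis scale_sum_right)
    also have "\<dots> = (\<Sum>n. c *s part n x)"
      using fin by (intro Sum_any.expand_superset[symmetric]) auto
    finally show "P (c *s x) (\<lambda>n. c *s part n x)"
      using f by (simp add: P_def subspace_scale sub part_mem)
  qed
  have part_homogeneous: "part m x = (if m = n then x else 0)" if "x \<in> A n" for m n x
  proof (rule part_eqI)
    have "finite {m. (if m = n then x else 0) \<noteq> 0}"
      by (rule finite_subset[of _ "{n}"]) auto
    then show "P x (\<lambda>m. if m = n then x else 0)"
      using that by (simp add: P_def subspace_0 sub)
  qed
  have part_0: "part n 0 = 0" for n
    using part_add[of n 0 0] by simp
  have part_sum: "part n (sum f I) = (\<Sum>i\<in>I. part n (f i))" for n f and I :: "nat set"
    by (induction I rule: infinite_finite_induct) (simp_all add: part_add part_0)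
  \<comment> \<open>The degrees that occur. A finite spanning set whose members have finite support
    involves only finitely many.\<close>
  define J where "J = {n. \<exists>x. part n x \<noteq> 0}"
  have "finite J"
  proof -
    obtain B where B: "finite B" "span B = UNIV"
      using finite_dim by blast
    have "part n x = 0" if "n \<notin> (\<Union>b\<in>B. {n. part n b \<noteq> 0})" for n x
    proof -
      have "x \<in> span B"
        using B by simp
      then show ?thesis
        by (induction rule: span_induct_alt) (use that in \<open>auto simp: part_add part_scale part_0\<close>)
    qed
    then have "J \<subseteq> (\<Union>b\<in>B. {n. part n b \<noteq> 0})"
      unfolding J_def by blast
    moreover have "finite (\<Union>b\<in>B. {n. part n b \<noteq> 0})"
      using B(1) fin by blast
    ultimately show ?thesis
      by (rule finite_subset)
  qed
  have sum_superset: "(\<Sum>n\<in>I. part n x) = x" if "J \<subseteq> I" "finite I" for x I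
  proof -
    have "x = Sum_any (\<lambda>n. part n x)"
      using P_part[of x] by (simp add: P_def)
    also have "\<dots> = (\<Sum>n\<in>I. part n x)"
      by (rule Sum_any.expand_superset) (use that in \<open>auto simp: J_def\<close>)
    finally show ?thesis ..
  qed
  define d where "d = Max J"
  have J_sub: "J \<subseteq> {..d}"
    using \<open>finite J\<close> by (auto simp: d_def)
  have "J \<noteq> {}"
    using sum_superset[of "{}" 1] by auto
  then have "d \<in> J"
    unfolding d_def using \<open>finite J\<close> by (rule Max_in[rotated])
  have sum_part: "(\<Sum>n\<le>d. part n x) = x" for x
    using sum_superset[OF J_sub] by simp
  have part_beyond: "part n x = 0" if "d < n" for n x
    using that J_sub unfolding J_def by fastforce
  have part_mult: "part n (x * y) = (\<Sum>i\<le>n. part i x * part (n - i) y)" for n x y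
  proof -
    have "x * y = (\<Sum>i\<le>d. \<Sum>j\<le>d. part i x * part j y)"
      by (simp add: sum_part flip: sum_product)
    then have "part n (x * y) = (\<Sum>i\<le>d. \<Sum>j\<le>d. part n (part i x * part j y))"
      by (simp add: part_sum)
    \<comment> \<open>Subtraction on naturals truncates, so \<open>j = n - i\<close> means
      \<open>i + j = n\<close> only under the guard \<open>i \<le> n\<close>.\<close>
    also have "\<dots> = (\<Sum>i\<le>d. \<Sum>j\<le>d. if j = n - i then if i \<le> n then part i x * part j y else 0 else 0)"
      by (intro sum.cong refl)
        (auto simp: part_homogeneous[OF mult[OF part_mem part_mem]])
    also have "\<dots> = (\<Sum>i\<le>d. if i \<le> n then part i x * part (n - i) y else 0)"
      by (intro sum.cong refl) (auto simp: part_beyond)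
    also have "\<dots> = (\<Sum>i\<in>{..d} \<inter> {..n}. part i x * part (n - i) y)"
      by (subst sum.inter_restrict) simp_all
    also have "\<dots> = (\<Sum>i\<le>n. part i x * part (n - i) y)"
      by (intro sum.mono_neutral_left) (auto, metis mult_zero_left not_le part_beyond)
    finally show ?thesis .
  qed
  have part_part: "part m (part n x) = (if m = n then part n x else 0)" for m n x
    using part_homogeneous[OF part_mem] .
  \<comment> \<open>\<open>part 0 1\<close> acts as a unit on every homogeneous element, hence on
    their sum \<open>1\<close>.\<close>
  have "part 0 1 = 1"
  proof -
    have "part 0 1 * part n x = part n x" for n x
    proof -
      have "part n x = part n (1 * part n x)"
        by (simp add: part_part)
      also have "\<dots> = (\<Sum>i\<le>n. if i = 0 then part 0 1 * part n x else 0)"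
        unfolding part_mult by (intro sum.cong) (auto simp: part_part)
      finally show ?thesis
        by simp
    qed
    then have "(\<Sum>n\<le>d. part 0 1 * part n 1) = (\<Sum>n\<le>d. part n 1)"
      by simp
    then have "part 0 1 * (\<Sum>n\<le>d. part n 1) = (\<Sum>n\<le>d. part n 1)"
      by (simp only: sum_distrib_left)
    then show ?thesis
      by (simp add: sum_part)
  qed
  then have part_one: "part n 1 = (if n = 0 then 1 else 0)" for n
    using part_part[of n 0 1] by simp
  \<comment> \<open>The given isomorphism is only linear, so it shows that the degree zero part is
    the line through \<open>\<phi> 1\<close>; since \<open>1\<close> lies on this line, rescaling
    replaces \<open>\<phi> 1\<close> by \<open>1\<close>.\<close>
  have part_zero_scalar: "\<exists>c. part 0 x = c *s 1" for x
  proof -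
    interpret \<phi>: Vector_Spaces.linear "(*)" scale \<phi>
      by (rule \<phi>(1))
    have line: "\<exists>c. part 0 y = c *s \<phi> 1" for y
    proof -
      obtain c where "part 0 y = \<phi> c"
        using part_mem[of 0 y] \<phi>(2) by (auto simp: bij_betw_def)
      then have "part 0 y = c *s \<phi> 1"
        using \<phi>.scale[of c 1] by simp
      then show ?thesis ..
    qed
    obtain b where b: "1 = b *s \<phi> 1"
      using line[of 1] \<open>part 0 1 = 1\<close> by auto
    then have "b \<noteq> 0"
      by (metis scale_zero_left zero_neq_one)
    obtain c where "part 0 x = c *s \<phi> 1"
      using line by blast
    also have "\<dots> = (c / b) *s (b *s \<phi> 1)"
      using \<open>b \<noteq> 0\<close> by simp
    finally show ?thesis
      using b by auto
  qed
  have "graded_comm_algebra scale part d"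
    by unfold_locales (rule part_add part_scale part_part part_mult part_one sum_part part_zero_scalar)+
  moreover have "\<exists>x. part d x \<noteq> 0"
    using \<open>d \<in> J\<close> by (simp add: J_def)
  ultimately show thesis
    by (rule that)
qed

text \<open>An element outside \<open>filt 1\<close> differs from a nonzero scalar by an element of
  \<open>filt 1\<close>, so a larger ideal contains a unit.\<close>

lemma (in graded_comm_algebra) maximal_ideal_filt_1: "maximal_ideal (filt 1)"
  unfolding maximal_ideal_def
proof (intro conjI allI impI)
  show "ring_ideal (filt 1)"
    by (simp add: ring_ideal_def part_add part_zero_mult)
  show "filt 1 \<noteq> UNIV"
    using part_one[of 0] by (metis One_nat_def UNIV_I mem_filt_1 zero_neq_one)
  fix I assume I: "ring_ideal I \<and> filt 1 \<subseteq> I"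
  show "I = filt 1 \<or> I = UNIV"
  proof (rule disjCI)
    assume "I \<noteq> UNIV"
    have "x \<in> filt 1" if "x \<in> I" for x
    proof (rule ccontr)
      assume "x \<notin> filt 1"
      obtain c where c: "part 0 x = c *s 1"
        using part_zero_scalar by blast
      with \<open>x \<notin> filt 1\<close> have "c \<noteq> 0"
        by auto
      have "part 0 x - x \<in> filt 1"
        by (simp add: part_diff part_part)
      with I that have "(part 0 x - x) + x \<in> I"
        unfolding ring_ideal_def by blast
      then have "((1 / c) *s 1) * (c *s 1) \<in> I"
        using I by (simp add: c ring_ideal_def)
      then have "1 \<in> I"
        using \<open>c \<noteq> 0\<close> by (simp add: scale_mult_left)
      then have "y * 1 \<in> I" for y
        using I unfolding ring_ideal_def by blast
      with \<open>I \<noteq> UNIV\<close> show False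
        by auto
    qed
    with I show "I = filt 1"
      by blast
  qed
qed

text \<open>The top component kills the maximal ideal for degree reasons. As the annihilator is a
  line, any nonzero top element \<open>e\<close> spans it.\<close>

lemma graded_gorenstein_algebraE:
  fixes scale :: "'f::field_char_0 \<Rightarrow> 'a::comm_ring_1 \<Rightarrow> 'a" (infixr \<open>*s\<close> 75)
  assumes "gorenstein_algebra scale \<mm>" and "graded_algebra scale"
  obtains part d e \<omega> where "graded_frobenius_algebra scale part d e \<omega>"
    and "\<mm> = graded_comm_algebra.filt part 1"
    and "e \<in> annihilator \<mm>" and "\<omega> e = 1" and "\<And>x. x \<in> annihilator \<mm> \<Longrightarrow> \<exists>c. x = c *s e"
proof -
  interpret gorenstein_algebra scale \<mm>
    by fact
  obtain part d where "graded_comm_algebra scale part d" and top: "\<exists>x. part d x \<noteq> 0"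
    using graded_algebraE[OF finite_dim assms(2)] by blast
  then interpret graded_comm_algebra scale part d
    by simp
  have \<mm>: "\<mm> = filt 1"
    using unique_maximal maximal_ideal_filt_1 by blast
  have ann_iff: "x \<in> annihilator \<mm> \<longleftrightarrow> x \<in> filt 1 \<and> (\<forall>v\<in>filt 1. x * v = 0)" for x
    by (simp add: annihilator_def \<mm>)
  \<comment> \<open>Otherwise every element would be a scalar, contrary to
    \<open>dim_gt_1\<close>.\<close>
  have d: "0 < d"
  proof (rule ccontr)
    assume "\<not> 0 < d"
    then have "x = part 0 x" for x
      using sum_part[of x] by simp
    then have "x \<in> span {1}" for x
      using part_zero_scalar[of x] by (metis span_base span_scale singletonI)
    then have "UNIV \<subseteq> span {1}"
      by blast
    then have "dim UNIV \<le> card {1 :: 'a}"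
      by (rule dim_le_card) simp
    with dim_gt_1 show False
      by simp
  qed
  have top_ann: "part d x \<in> annihilator \<mm>" for x
    unfolding ann_iff
  proof (intro conjI ballI)
    show "part d x \<in> filt 1"
      using d by (simp add: part_part)
    fix v assume "v \<in> filt 1"
    moreover have "part d x \<in> filt d"
      by (simp add: filt_def part_part)
    ultimately have "part d x * v \<in> filt (d + 1)"
      by (intro filt_mult)
    then show "part d x * v = 0"
      by (rule filt_eq_0) simp
  qed
  obtain x0 where "part d x0 \<noteq> 0"
    using top by blast
  define e where "e = part d x0"
  have e: "e \<in> annihilator \<mm>" "e \<noteq> 0" "part d e = e"
    using top_ann \<open>part d x0 \<noteq> 0\<close> by (simp_all add: e_def part_part)
  have line: "\<exists>c. x = c *s e" if "x \<in> annihilator \<mm>" for x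
  proof -
    obtain B where "annihilator \<mm> \<subseteq> span B" "card B = 1"
      using basis_exists[of "annihilator \<mm>"] dim_annihilator by metis
    then obtain b where b: "annihilator \<mm> \<subseteq> span {b}"
      by (metis card_1_singletonE)
    have "\<exists>c. y = c *s b" if "y \<in> annihilator \<mm>" for y
      using b that by (auto simp: span_singleton)
    then obtain c c' where c: "x = c *s b" "e = c' *s b"
      using \<open>x \<in> annihilator \<mm>\<close> e(1) by blast
    with e(2) have "c' \<noteq> 0"
      by auto
    with c have "x = (c / c') *s e"
      by simp
    then show ?thesis ..
  qed
  have "\<forall>x. \<exists>c. part d x = c *s e"
    using line top_ann by blast
  then obtain \<omega> where \<omega>: "part d x = \<omega> x *s e" for x
    by metis
  have \<omega>_e: "\<omega> (c *s e) = c" for c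
    using \<omega>[of "c *s e"] e(2,3) by (simp add: part_scale)
  \<comment> \<open>Among the nonzero multiples of \<open>x\<close>, one of largest order is killed
    by \<open>filt 1\<close>. It is therefore a nonzero multiple of \<open>e\<close>, on which
    \<omega> does not vanish.\<close>
  have "x = 0" if *: "\<And>y. \<omega> (x * y) = 0" for x
  proof (rule ccontr)
    assume "x \<noteq> 0"
    define Q where "Q n \<longleftrightarrow> (\<exists>y. x * y \<noteq> 0 \<and> x * y \<in> filt n)" for n
    have "Q 0"
      unfolding Q_def using \<open>x \<noteq> 0\<close> by (intro exI[of _ 1]) simp
    have "n \<le> d" if "Q n" for n
      using that filt_eq_0 unfolding Q_def by (meson not_le)
    then obtain n where n: "Q n" "\<And>m. Q m \<Longrightarrow> m \<le> n"
      using GreatestI_nat[of Q 0 d] Greatest_le_nat[of Q _ d] \<open>Q 0\<close> by metis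
    then obtain y where y: "x * y \<noteq> 0" "x * y \<in> filt n"
      unfolding Q_def by blast
    have socle: "x * y * v = 0" if "v \<in> filt 1" for v
    proof (rule ccontr)
      assume "x * y * v \<noteq> 0"
      moreover have "x * y * v \<in> filt (n + 1)"
        using y(2) that by (rule filt_mult)
      ultimately have "Q (n + 1)"
        unfolding Q_def by (metis mult.assoc)
      with n(2) show False
        by fastforce
    qed
    \<comment> \<open>If \<open>c\<close> is the scalar part, then \<open>x * y * e\<close> equals
      both \<open>c *s e\<close> and zero.\<close>
    have "x * y \<in> filt 1"
    proof -
      obtain c where c: "part 0 (x * y) = c *s 1"
        using part_zero_scalar by blast
      have "e \<in> filt 1"
        using e(1) ann_iff by blast
      have "e * (x * y - part 0 (x * y)) = 0"
        using e(1) unfolding ann_iff by (simp add: part_diff part_part)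
      then have "c *s e = x * y * e"
        by (simp add: c scale_mult_right algebra_simps)
      with socle[OF \<open>e \<in> filt 1\<close>] e(2) have "c = 0"
        by simp
      then show ?thesis
        by (simp add: c)
    qed
    with socle have "x * y \<in> annihilator \<mm>"
      unfolding ann_iff by blast
    then obtain c where "x * y = c *s e"
      using line by blast
    with *[of y] y(1) show False
      by (simp add: \<omega>_e)
  qed
  then have "graded_frobenius_algebra scale part d e \<omega>"
    by unfold_locales (use \<omega> e(2) d finite_dim in blast)+
  moreover have "\<omega> e = 1"
    using \<omega>_e[of 1] by simp
  ultimately show thesis
    using \<mm> e(1) line
    by (intro that[of part d e \<omega>])
qed

section \<open>The admissible projection as a functional\<close>

theorem corollary2p5:
  fixes scale :: "'f::field_char_0 \<Rightarrow> 'a::comm_ring_1 \<Rightarrow> 'a"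
    and \<mm> :: "'a set" and \<pi> :: "'a \<Rightarrow> 'a"
  assumes "gorenstein_algebra scale \<mm>"
    and "admissible_projection scale \<mm> \<pi>"
    and "graded_algebra scale"
  shows "affine_homogeneous scale \<mm> (hypersurface scale \<mm> \<pi>)"
proof -
  obtain part d e \<omega> where "graded_frobenius_algebra scale part d e \<omega>"
    and \<mm>': "\<mm> = graded_comm_algebra.filt part 1"
    and e: "e \<in> annihilator \<mm>" and \<omega>_e: "\<omega> e = 1" and line: "\<And>x. x \<in> annihilator \<mm> \<Longrightarrow> \<exists>c. x = scale c e"
    using graded_gorenstein_algebraE[OF assms(1,3)] by metis
  then interpret graded_frobenius_algebra scale part d e \<omega>
    by simp
  have \<mm>: "\<mm> = filt 1"
    by (rule \<mm>')
  have \<pi>_add: "\<pi> (x + y) = \<pi> x + \<pi> y" if "x \<in> \<mm>" "y \<in> \<mm>" for x y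
    using assms(2) that unfolding admissible_projection_def linear_map_on_def by blast
  have \<pi>_scale: "\<pi> (scale c x) = scale c (\<pi> x)" if "x \<in> \<mm>" for c x
    using assms(2) that unfolding admissible_projection_def linear_map_on_def by blast
  have \<pi>_ann: "\<pi> x \<in> annihilator \<mm>" if "x \<in> \<mm>" for x
    using assms(2) that unfolding admissible_projection_def by blast
  have \<pi>_e: "\<pi> e = e"
    using assms(2) e unfolding admissible_projection_def by (metis imageE)
  have e_filt: "e \<in> filt 1" and e_ann: "\<And>x. x \<in> filt 1 \<Longrightarrow> e * x = 0"
    using e unfolding annihilator_def \<mm> by blast+
  have reduced: "x - part 0 x \<in> \<mm>" for x
    by (simp add: \<mm> part_diff part_part)
  \<comment> \<open>Subtracting the scalar part extends the coordinate of \<pi> along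
    \<open>e\<close> from the maximal ideal to a functional on the whole algebra that vanishes at
    \<open>1\<close>.\<close>
  have "\<forall>x. \<exists>c. \<pi> (x - part 0 x) = scale c e"
    using line \<pi>_ann reduced by blast
  then obtain \<mu> where \<mu>: "\<pi> (x - part 0 x) = scale (\<mu> x) e" for x
    by metis
  have "\<mu> (x + y) = \<mu> x + \<mu> y" for x y
  proof -
    have "\<pi> (x + y - part 0 (x + y)) = \<pi> ((x - part 0 x) + (y - part 0 y))"
      by (simp add: part_add algebra_simps)
    then have "scale (\<mu> (x + y)) e = scale (\<mu> x + \<mu> y) e"
      by (simp only: \<pi>_add[OF reduced reduced] \<mu> scale_left_distrib)
    with e_nonzero show ?thesis
      by (rule scale_right_imp_eq)
  qed
  moreover have "\<mu> (scale c x) = c * \<mu> x" for c x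
  proof -
    have "\<pi> (scale c x - part 0 (scale c x)) = \<pi> (scale c (x - part 0 x))"
      by (simp add: part_scale scale_right_diff_distrib)
    then have "scale (\<mu> (scale c x)) e = scale (c * \<mu> x) e"
      by (simp only: \<pi>_scale[OF reduced] \<mu> scale_scale)
    with e_nonzero show ?thesis
      by (rule scale_right_imp_eq)
  qed
  ultimately obtain g where g: "\<And>x. \<omega> (g * x) = \<mu> x"
    using functional_represented by blast
  have \<mu>_1: "\<mu> 1 = 0"
  proof -
    have "\<pi> 0 = 0"
      using \<pi>_add[of 0 0] by (simp add: \<mm>)
    then show ?thesis
      using \<mu>[of 1] e_nonzero by (simp add: part_one)
  qed
  \<comment> \<open>As \<open>e\<close> kills the maximal ideal, \<open>g * e\<close> depends only
    on the scalar part of \<open>g\<close>, which \<open>\<pi> e = e\<close> forces to be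
    \<open>1\<close>.\<close>
  have part_g: "part 0 g = 1"
  proof -
    obtain c where c: "part 0 g = scale c 1"
      using part_zero_scalar by blast
    have "(g - part 0 g) * e = 0"
      using e_ann[OF reduced[unfolded \<mm>], of g] by (simp add: mult.commute)
    then have "g * e = scale c e"
      by (simp add: c left_diff_distrib scale_mult_left)
    moreover have "scale (\<mu> e) e = e"
      using \<mu>[of e] \<pi>_e e_filt by simp
    then have "\<mu> e = 1"
      using e_nonzero by (metis scale_one scale_right_imp_eq)
    ultimately show ?thesis
      using g[of e] by (simp add: c functional_scale \<omega>_e)
  qed
  have "\<pi> (2 * u + u\<^sup>2) = 0 \<longleftrightarrow> \<omega> (g * (1 + u)\<^sup>2) = 0" if "u \<in> \<mm>" for u
  proof -
    have "part 0 (2 * u + u\<^sup>2) = 0"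
      using that by (simp add: \<mm> part_add part_zero_mult part_zero_power)
    then have "\<pi> (2 * u + u\<^sup>2) = scale (\<mu> (2 * u + u\<^sup>2)) e"
      using \<mu>[of "2 * u + u\<^sup>2"] by simp
    \<comment> \<open>Completing the square costs only the constant \<open>1\<close>, where \<mu>
      vanishes.\<close>
    moreover have "g * (1 + u)\<^sup>2 = g * 1 + g * (2 * u + u\<^sup>2)"
      by (simp add: power2_eq_square algebra_simps)
    then have "\<omega> (g * (1 + u)\<^sup>2) = \<mu> (2 * u + u\<^sup>2)"
      by (simp only: functional_add g \<mu>_1 add_0)
    ultimately show ?thesis
      using e_nonzero by simp
  qed
  then have "hypersurface scale \<mm> \<pi> = log_quadric g"
    unfolding hypersurface_def affine_quadric_def log_quadric_def by (auto simp: \<mm> intro!: image_eqI)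
  then show ?thesis
    using affine_homogeneous_log_quadric[OF part_g] by (simp only: \<mm>)
qed

end
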